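(* Suppose that $f:\mathbb{Z}_{\ge 0}^3\to\mathbb{R}$, $(t,x,y)\mapsto f(t,x,y)$, satisfies the difference equations $$(p+q)\,\frac{1}{2}\,\Delta_x^+\Delta_x^- f(t,x,y)-(p-q)\,\frac{\Delta_x^+ +\Delta_x^-}{2}f(t,x,y)+\Delta_t^- f(t,x,y)=0$$ for all integers $t\ge 2$, $x\ge 1$, $y\ge 0$, and $$p\,\Delta_y^+ f(t,0,y)+q\,\Delta_x^+ f(t,0,y)+\Delta_t^- f(t,0,y)=0$$ for all integers $t\ge 1$, $y\ge 0$. Then the process $\{f(t,M_t-Z_t,M_t)\}_{t=0}^\infty$ is a martingale with respect to the filtration $(\mathcal{F}_t)_{t\ge 0}$.
   Context: $\mathbb{Z}_{\ge 0}$ denotes the set of nonnegative integers. Let $\xi_1,\xi_2,\dots$ be i.i.d. random variables on a probability space $(\Omega,\mathcal{F},P)$ with $P(\xi_1=1)=p$, $P(\xi_1=-1)=q$, $P(\xi_1=0)=r$, where $p>0$, $q>0$ (and $r\ge 0$), $p+q+r=1$. The random walk is $Z_0=0$, $Z_{t+1}=Z_t+\xi_{t+1}$ for $t\in\mathbb{Z}_{\ge 0}$, its maximum process is $M_t=\max_{0\le s\le t}Z_s$, and the filtration is the natural one, $\mathcal{F}_t=\sigma(Z_s: s\le t)$. The difference operators are $\Delta_t^- f(t,x,y)=f(t,x,y)-f(t-1,x,y)$, $\Delta_x^+ f(t,x,y)=f(t,x+1,y)-f(t,x,y)$, $\Delta_x^- f(t,x,y)=f(t,x,y)-f(t,x-1,y)$,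 $\Delta_y^+ f(t,x,y)=f(t,x,y+1)-f(t,x,y)$. In particular $\Delta_x^+\Delta_x^- f(t,x,y)=f(t,x+1,y)-2f(t,x,y)+f(t,x-1,y)$, and $(\Delta_x^+ +\Delta_x^-)f=\Delta_x^+f+\Delta_x^-f$. *)

theory Defs
  imports "HOL-Probability.Probability"
begin

text \<open>
  The difference operators act on functions of \<open>(t, x, y)\<close> with natural number arguments.
  The backward operators use truncated subtraction, so they have their intended
  meaning only where the decremented argument is at least 1.
\<close>

definition diff_t_minus :: "(nat \<Rightarrow> nat \<Rightarrow> nat \<Rightarrow> real) \<Rightarrow> nat \<Rightarrow> nat \<Rightarrow> nat \<Rightarrow> real" where
  "diff_t_minus f t x y = f t x y - f (t - 1) x y"

definition diff_x_plus :: "(nat \<Rightarrow> nat \<Rightarrow> nat \<Rightarrow> real) \<Rightarrow> nat \<Rightarrow> nat \<Rightarrow> nat \<Rightarrow> real" where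
  "diff_x_plus f t x y = f t (x + 1) y - f t x y"

definition diff_x_minus :: "(nat \<Rightarrow> nat \<Rightarrow> nat \<Rightarrow> real) \<Rightarrow> nat \<Rightarrow> nat \<Rightarrow> nat \<Rightarrow> real" where
  "diff_x_minus f t x y = f t x y - f t (x - 1) y"

definition diff_y_plus :: "(nat \<Rightarrow> nat \<Rightarrow> nat \<Rightarrow> real) \<Rightarrow> nat \<Rightarrow> nat \<Rightarrow> nat \<Rightarrow> real" where
  "diff_y_plus f t x y = f t x (y + 1) - f t x y"

text \<open>The increments are \<open>\<xi> 1, \<xi> 2, \<dots>\<close>; the value \<open>\<xi> 0\<close> is never used.\<close>

primrec walk :: "(nat \<Rightarrow> 'a \<Rightarrow> int) \<Rightarrow> nat \<Rightarrow> 'a \<Rightarrow> int" where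
  "walk \<xi> 0 \<omega> = 0"
| "walk \<xi> (Suc t) \<omega> = walk \<xi> t \<omega> + \<xi> (Suc t) \<omega>"

definition running_max :: "(nat \<Rightarrow> 'a \<Rightarrow> int) \<Rightarrow> nat \<Rightarrow> 'a \<Rightarrow> int" where
  "running_max Z t \<omega> = Max ((\<lambda>s. Z s \<omega>) ` {0..t})"

definition natural_filtration :: "'a measure \<Rightarrow> (nat \<Rightarrow> 'a \<Rightarrow> int) \<Rightarrow> nat \<Rightarrow> 'a measure" where
  "natural_filtration P Z t = sigma (space P) {Z s -` A \<inter> space P |s A. s \<le> t}"

text \<open>
  In the following definition \<open>AE\<close> refers to the ambient measure \<open>P\<close>; only the \<open>\<sigma>\<close>-algebra
  of each \<open>F t\<close> matters.
\<close>

definition martingale :: "'a measure \<Rightarrow> (nat \<Rightarrow> 'a measure) \<Rightarrow> (nat \<Rightarrow> 'a \<Rightarrow> real) \<Rightarrow> bool" where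
  "martingale P F X \<longleftrightarrow>
     filtration (space P) F \<and>
     (\<forall>t. subalgebra P (F t)) \<and>
     (\<forall>t. X t \<in> borel_measurable (F t)) \<and>
     (\<forall>t. integrable P (X t)) \<and>
     (\<forall>s t. s \<le> t \<longrightarrow> (AE \<omega> in P. real_cond_exp P (F s) (X t) \<omega> = X s \<omega>))"

definition iid_sequence :: "'a measure \<Rightarrow> (nat \<Rightarrow> 'a \<Rightarrow> int) \<Rightarrow> bool" where
  "iid_sequence P \<xi> \<longleftrightarrow>
     prob_space.indep_vars P (\<lambda>_. count_space UNIV) \<xi> {1..} \<and>
     (\<forall>i\<ge>1. distr P (count_space UNIV) (\<xi> i) = distr P (count_space UNIV) (\<xi> 1))"

end

theory Submission
  imports Defs
begin

text \<open>
  Put \<open>X = M - Z\<close>. A step \<open>e\<close> of the walk moves \<open>(X, M)\<close> from \<open>(x, y)\<close> to \<open>(x - e, y)\<close>,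
  except that an up-step from \<open>x = 0\<close> pushes the maximum and leads to \<open>(0, y + 1)\<close>.
  Multiplying out the difference operators turns the two difference equations into
  \[ p f(t+1,x-1,y) + q f(t+1,x+1,y) + r f(t+1,x,y) = f(t,x,y) \quad (t \ge 1, x \ge 1), \]
  \[ p f(t+1,0,y+1) + q f(t+1,1,y) + r f(t+1,0,y) = f(t,0,y) \quad (t \ge 0), \]
  that is, \<open>f t x y\<close> is the weighted average of \<open>f (t + 1)\<close> over the possible successors of \<open>(x, y)\<close>
  (lemma \<open>successor_average\<close>). The first identity says nothing about \<open>t = 0\<close>, but the process
  starts at \<open>x = 0\<close>, where the second one applies.

  It remains to see that the conditional expectation given the past really is this average
  (lemma \<open>cond_exp_one_step\<close>). Almost surely, a function of \<open>(M, Z)\<close> at time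
  \<open>t + 1\<close> is the sum over \<open>e \<in> {-1, 0, 1}\<close> of a function of \<open>(M, Z)\<close> at time \<open>t\<close> times the indicator
  of \<open>{\<xi> (t + 1) = e}\<close>. The first factor is known at time \<open>t\<close> and can be taken out; the
  event is independent of the past, so its conditional expectation is its probability.
  All variables are integrable because at time \<open>t\<close> the walk and its maximum
  almost surely take only finitely many values. The martingale property over several steps then
  follows from the tower property (lemma \<open>martingale_of_one_step\<close>).
\<close>

section \<open>Conditional expectations and martingales\<close>

lemma (in prob_space) real_cond_exp_indicator_indep:
  assumes F: "subalgebra M F" and B: "B \<in> events"
    and indep: "\<And>A. A \<in> sets F \<Longrightarrow> prob (A \<inter> B) = prob A * prob B"
  shows "AE \<omega> in M. real_cond_exp M F (indicator B) \<omega> = prob B"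
proof -
  interpret finite_measure_subalgebra M F
    by unfold_locales (rule F)
  show ?thesis
  proof (rule real_cond_exp_charact)
    fix A assume A: "A \<in> sets F"
    then have [measurable]: "A \<in> events" using F by (auto simp: subalgebra_def)
    have "(LINT \<omega>:A|M. indicator B \<omega>) = (LINT \<omega>|M. indicator (A \<inter> B) \<omega> :: real)"
      by (simp add: set_lebesgue_integral_def indicator_inter_arith)
    also have "\<dots> = prob A * prob B"
      using B by (simp add: indep[OF A])
    also have "\<dots> = (LINT \<omega>:A|M. prob B)"
      by (simp add: set_lebesgue_integral_def)
    finally show "(LINT \<omega>:A|M. indicator B \<omega>) = (LINT \<omega>:A|M. prob B)" .
  qed (use B in \<open>auto simp: less_top[symmetric]\<close>)
qed

text \<open>
  Conditioning \<open>X (t + 1)\<close> on \<open>F s\<close> can be done in two stages, first on the larger \<open>F t\<close>,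
  which by the one-step identity leaves \<open>X t\<close>; induction on \<open>t\<close> then descends to \<open>X s\<close>.
\<close>

lemma (in prob_space) martingale_of_one_step:
  assumes filt: "filtration (space M) F"
    and sub: "\<And>t. subalgebra M (F t)"
    and meas: "\<And>t. X t \<in> borel_measurable (F t)"
    and int: "\<And>t. integrable M (X t)"
    and step: "\<And>t. AE \<omega> in M. real_cond_exp M (F t) (X (Suc t)) \<omega> = X t \<omega>"
  shows "martingale M F X"
proof -
  have fin: "finite_measure_subalgebra M (F s)" for s
    by unfold_locales (rule sub)
  have "AE \<omega> in M. real_cond_exp M (F s) (X t) \<omega> = X s \<omega>" if "s \<le> t" for s t
    using that
  proof (induction t rule: dec_induct)
    case base
    interpret finite_measure_subalgebra M "F s" by (rule fin)
    show ?case by (rule real_cond_exp_F_meas[OF int meas])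
  next
    case (step t)
    interpret finite_measure_subalgebra M "F s" by (rule fin)
    have "subalgebra (F t) (F s)"
      using filtration.sets_F_mono[OF filt \<open>s \<le> t\<close>] filtration.space_F[OF filt]
      by (simp add: subalgebra_def)
    then have "AE \<omega> in M. real_cond_exp M (F s) (real_cond_exp M (F t) (X (Suc t))) \<omega>
        = real_cond_exp M (F s) (X (Suc t)) \<omega>"
      by (rule real_cond_exp_nested_subalg[OF sub _ int])
    moreover have "AE \<omega> in M. real_cond_exp M (F s) (real_cond_exp M (F t) (X (Suc t))) \<omega>
        = real_cond_exp M (F s) (X t) \<omega>"
      by (rule real_cond_exp_cong[OF assms(5)])
        (use int in \<open>auto intro: borel_measurable_cond_exp2\<close>)
    ultimately show ?case using step.IH by eventually_elim simp
  qed
  then show ?thesis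
    unfolding martingale_def using filt sub meas int by blast
qed

section \<open>The walk, its maximum and its natural filtration\<close>

lemma running_max_0 [simp]: "running_max Z 0 \<omega> = Z 0 \<omega>"
  by (simp add: running_max_def)

lemma running_max_Suc [simp]:
  "running_max Z (Suc t) \<omega> = max (running_max Z t \<omega>) (Z (Suc t) \<omega>)"
proof -
  have "{0..Suc t} = insert (Suc t) {0..t}" by auto
  then show ?thesis by (simp add: running_max_def max.commute)
qed

lemma le_running_max: "s \<le> t \<Longrightarrow> Z s \<omega> \<le> running_max Z t \<omega>"
  by (auto simp: running_max_def intro!: Max_ge)

lemma space_natural_filtration [simp]: "space (natural_filtration P Z t) = space P"
  by (auto simp: natural_filtration_def intro!: space_measure_of)

lemma sets_natural_filtration:
  "sets (natural_filtration P Z t)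
     = sigma_sets (space P) {Z s -` A \<inter> space P |s A. s \<le> t}"
  by (auto simp: natural_filtration_def intro!: sets_measure_of)

lemma filtration_natural_filtration: "filtration (space P) (natural_filtration P Z)"
proof
  fix i j :: nat assume "i \<le> j"
  then show "sets (natural_filtration P Z i) \<subseteq> sets (natural_filtration P Z j)"
    unfolding sets_natural_filtration by (intro sigma_sets_mono') force
qed simp

lemma measurable_natural_filtration:
  "s \<le> t \<Longrightarrow> Z s \<in> measurable (natural_filtration P Z t) (count_space UNIV)"
  by (rule measurableI) (auto simp: sets_natural_filtration)

lemma sets_natural_filtration_subset:
  assumes "space N = space P" and "\<And>s. s \<le> t \<Longrightarrow> Z s \<in> measurable N (count_space UNIV)"
  shows "sets (natural_filtration P Z t) \<subseteq> sets N"
proof -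
  have "Z s -` A \<inter> space P \<in> sets N" if "s \<le> t" for s A
    using measurable_sets[OF assms(2)[OF that], of A] assms(1) by simp
  then show ?thesis
    unfolding sets_natural_filtration assms(1)[symmetric]
    by (intro sets.sigma_sets_subset) auto
qed

text \<open>Countability of the integers makes every such combination measurable.\<close>

lemma measurable_function_of_two_ints:
  fixes a b :: "'a \<Rightarrow> int"
  assumes a: "a \<in> measurable N (count_space UNIV)" and b: "b \<in> measurable N (count_space UNIV)"
  shows "(\<lambda>\<omega>. h (a \<omega>) (b \<omega>)) \<in> measurable N (count_space UNIV)"
  by (rule measurable_compose_countable[OF measurable_compose_countable[OF _ b] a]) simp

lemma measurable_walk:
  assumes "\<And>i. 1 \<le> i \<Longrightarrow> i \<le> t \<Longrightarrow> \<xi> i \<in> measurable N (count_space UNIV)"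
  shows "walk \<xi> t \<in> measurable N (count_space UNIV)"
  using assms
proof (induction t)
  case (Suc t)
  have "(\<lambda>\<omega>. walk \<xi> t \<omega> + \<xi> (Suc t) \<omega>) \<in> measurable N (count_space UNIV)"
    by (rule measurable_function_of_two_ints[where h = "(+)"]) (simp_all add: Suc)
  then show ?case by (simp add: walk.simps(2)[abs_def])
qed (simp add: walk.simps(1)[abs_def])

lemma measurable_running_max:
  assumes "\<And>s. s \<le> t \<Longrightarrow> Z s \<in> measurable N (count_space UNIV)"
  shows "running_max Z t \<in> measurable N (count_space UNIV)"
  using assms
proof (induction t)
  case 0
  then have "(\<lambda>\<omega>. Z 0 \<omega>) \<in> measurable N (count_space UNIV)" by simp
  then show ?case by (subst measurable_cong[where g = "Z 0"]) auto
next
  case (Suc t)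
  have "(\<lambda>\<omega>. max (running_max Z t \<omega>) (Z (Suc t) \<omega>)) \<in> measurable N (count_space UNIV)"
    by (rule measurable_function_of_two_ints[where h = max]) (simp_all add: Suc)
  then show ?case by (subst measurable_cong[OF running_max_Suc])
qed

section \<open>One step of the lazy walk\<close>

locale lazy_walk = prob_space P for P :: "'a measure" +
  fixes \<xi> :: "nat \<Rightarrow> 'a \<Rightarrow> int" and p q r :: real
  assumes iid: "iid_sequence P \<xi>"
    and total: "p + q + r = 1"
    and up: "prob {\<omega> \<in> space P. \<xi> 1 \<omega> = 1} = p"
    and down: "prob {\<omega> \<in> space P. \<xi> 1 \<omega> = - 1} = q"
    and stay: "prob {\<omega> \<in> space P. \<xi> 1 \<omega> = 0} = r"
begin

abbreviation Z where "Z \<equiv> walk \<xi>"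
abbreviation M where "M \<equiv> running_max Z"
abbreviation \<F> where "\<F> \<equiv> natural_filtration P Z"

lemma indep_increments: "indep_vars (\<lambda>_. count_space UNIV) \<xi> {1..}"
  using iid by (simp add: iid_sequence_def)

lemma measurable_increment: "i \<ge> 1 \<Longrightarrow> \<xi> i \<in> measurable P (count_space UNIV)"
  using indep_increments by (auto simp: indep_vars_def)

lemma prob_increment:
  assumes "i \<ge> 1"
  shows "prob {\<omega> \<in> space P. \<xi> i \<omega> = e} = prob {\<omega> \<in> space P. \<xi> 1 \<omega> = e}"
proof -
  have "prob {\<omega> \<in> space P. \<xi> j \<omega> = e} = measure (distr P (count_space UNIV) (\<xi> j)) {e}"
    if "j \<ge> 1" for j
    using measurable_increment[OF that]
    by (subst measure_distr) (auto intro!: arg_cong[where f = prob])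
  moreover have "distr P (count_space UNIV) (\<xi> i) = distr P (count_space UNIV) (\<xi> 1)"
    using iid assms unfolding iid_sequence_def by blast
  ultimately show ?thesis using assms by (metis order_refl)
qed

lemma increment_event: "i \<ge> 1 \<Longrightarrow> {\<omega> \<in> space P. \<xi> i \<omega> = e} \<in> events"
  using measurable_sets[OF measurable_increment, of i "{e}"]
  by (simp add: vimage_def Int_def conj_commute)

lemma AE_increment:
  assumes i: "i \<ge> 1"
  shows "AE \<omega> in P. \<xi> i \<omega> \<in> {- 1, 0, 1}"
proof -
  let ?E = "\<lambda>e. {\<omega> \<in> space P. \<xi> i \<omega> = e}"
  have "prob (?E 1 \<union> ?E (- 1) \<union> ?E 0) = prob (?E 1) + prob (?E (- 1)) + prob (?E 0)"
    using increment_event[OF i]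
    by (subst finite_measure_Union, auto)+
  also have "\<dots> = 1"
    using total by (simp only: prob_increment[OF i] up down stay)
  finally have "AE \<omega> in P. \<omega> \<in> ?E 1 \<union> ?E (- 1) \<union> ?E 0"
    using increment_event[OF i] by (intro AE_prob_1) auto
  then show ?thesis by eventually_elim auto
qed

lemma AE_walk_bounds: "AE \<omega> in P. \<bar>Z t \<omega>\<bar> \<le> int t \<and> 0 \<le> M t \<omega> \<and> M t \<omega> \<le> int t"
proof (induction t)
  case (Suc t)
  have "AE \<omega> in P. \<xi> (Suc t) \<omega> \<in> {- 1, 0, 1}" by (rule AE_increment) simp
  with Suc show ?case by eventually_elim auto
qed simp

lemma measurable_walk_events: "Z s \<in> measurable P (count_space UNIV)"
  by (rule measurable_walk) (rule measurable_increment)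

lemma subalgebra_natural_filtration: "subalgebra P (\<F> t)"
  unfolding subalgebra_def
  using sets_natural_filtration_subset[of P P, OF _ measurable_walk_events] by auto

lemma borel_measurable_max_walk:
  fixes h :: "int \<Rightarrow> int \<Rightarrow> real"
  shows "(\<lambda>\<omega>. h (M t \<omega>) (Z t \<omega>)) \<in> borel_measurable (\<F> t)"
proof -
  have "(\<lambda>\<omega>. h (M t \<omega>) (Z t \<omega>)) \<in> measurable (\<F> t) (count_space UNIV)"
    by (rule measurable_function_of_two_ints[OF measurable_running_max])
      (auto intro: measurable_natural_filtration)
  then show ?thesis
    by (rule measurable_compose) simp
qed

lemma integrable_max_walk:
  fixes h :: "int \<Rightarrow> int \<Rightarrow> real"
  shows "integrable P (\<lambda>\<omega>. h (M t \<omega>) (Z t \<omega>))"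
proof (rule integrable_const_bound)
  \<comment> \<open>The bound is finite because almost surely \<open>(M t, Z t)\<close> lies in the finite set \<open>?S\<close>.\<close>
  let ?S = "{0..int t} \<times> {- int t..int t}"
  show "AE \<omega> in P. norm (h (M t \<omega>) (Z t \<omega>)) \<le> (\<Sum>(m, z)\<in>?S. \<bar>h m z\<bar>)"
    using AE_walk_bounds[of t]
  proof eventually_elim
    case (elim \<omega>)
    then have "(M t \<omega>, Z t \<omega>) \<in> ?S" by auto
    then have "(case (M t \<omega>, Z t \<omega>) of (m, z) \<Rightarrow> \<bar>h m z\<bar>) \<le> (\<Sum>(m, z)\<in>?S. \<bar>h m z\<bar>)"
      by (intro member_le_sum) auto
    then show ?case by simp
  qed
  show "(\<lambda>\<omega>. h (M t \<omega>) (Z t \<omega>)) \<in> borel_measurable P"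
    by (rule measurable_from_subalg[OF subalgebra_natural_filtration borel_measurable_max_walk])
qed

text \<open>
  The past up to time \<open>t\<close> is contained in the \<open>\<sigma>\<close>-algebra generated by the vector of the first
  \<open>t\<close> increments, and this vector is independent of the next increment.
\<close>

lemma indep_past_increment:
  assumes A: "A \<in> sets (\<F> t)"
  shows "prob (A \<inter> {\<omega> \<in> space P. \<xi> (Suc t) \<omega> = e})
    = prob A * prob {\<omega> \<in> space P. \<xi> (Suc t) \<omega> = e}"
proof -
  let ?N = "\<lambda>I. PiM I (\<lambda>_::nat. count_space (UNIV :: int set))"
  let ?past = "\<lambda>\<omega>. restrict (\<lambda>i. \<xi> i \<omega>) {1..t}"
  let ?next = "\<lambda>\<omega>. restrict (\<lambda>i. \<xi> i \<omega>) {Suc t}"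
  let ?V = "vimage_algebra (space P) ?past (?N {1..t})"
  \<comment> \<open>Every event of \<open>?V\<close> is a preimage under the vector of increments, which is the
    form in which the product formula for independent vectors applies to \<open>A\<close>.\<close>
  have past_space: "?past \<in> space P \<rightarrow> space (?N {1..t})"
    by (auto simp: space_PiM)
  have "\<xi> i \<in> measurable ?V (count_space UNIV)" if "1 \<le> i" "i \<le> t" for i
  proof -
    have "(\<lambda>\<omega>. ?past \<omega> i) \<in> measurable ?V (count_space UNIV)"
      by (rule measurable_compose[OF measurable_vimage_algebra1[OF past_space]
            measurable_component_singleton]) (use that in auto)
    then show ?thesis using that by simp
  qed
  then have "sets (\<F> t) \<subseteq> sets ?V"
    by (intro sets_natural_filtration_subset measurable_walk) auto
  with A obtain B where B: "B \<in> sets (?N {1..t})" "A = ?past -` B \<inter> space P"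
    unfolding sets_vimage_algebra2[OF past_space] by auto
  let ?C = "{g \<in> space (?N {Suc t}). g (Suc t) = e}"
  have C: "?C \<in> sets (?N {Suc t})"
    by measurable
  have next_C: "?next -` ?C \<inter> space P = {\<omega> \<in> space P. \<xi> (Suc t) \<omega> = e}"
    by (auto simp: space_PiM)
  have "indep_var (?N {1..t}) ?past (?N {Suc t}) ?next"
    by (rule indep_var_restrict[OF indep_increments]) auto
  from indep_varD[OF this B(1) C]
  have "prob ((\<lambda>\<omega>. (?past \<omega>, ?next \<omega>)) -` (B \<times> ?C) \<inter> space P)
      = prob A * prob {\<omega> \<in> space P. \<xi> (Suc t) \<omega> = e}"
    unfolding next_C B(2) .
  moreover have "(\<lambda>\<omega>. (?past \<omega>, ?next \<omega>)) -` (B \<times> ?C) \<inter> space P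
      = A \<inter> {\<omega> \<in> space P. \<xi> (Suc t) \<omega> = e}"
    unfolding B(2) next_C[symmetric] by auto
  ultimately show ?thesis by simp
qed

text \<open>
  Almost surely the new increment is \<open>-1\<close>, \<open>0\<close> or \<open>1\<close>, so splitting according to its value
  separates the past (the factor \<open>G e\<close>, evaluated at time \<open>t\<close>) from the independent future (an indicator).
\<close>

lemma cond_exp_one_step:
  fixes h :: "int \<Rightarrow> int \<Rightarrow> real" and t :: nat
  defines "G \<equiv> (\<lambda>e \<omega>. h (max (M t \<omega>) (Z t \<omega> + e)) (Z t \<omega> + e))"
  shows "AE \<omega> in P. real_cond_exp P (\<F> t) (\<lambda>\<omega>. h (M (Suc t) \<omega>) (Z (Suc t) \<omega>)) \<omega>
           = p * G 1 \<omega> + q * G (- 1) \<omega> + r * G 0 \<omega>"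
proof -
  interpret finite_measure_subalgebra P "\<F> t"
    by unfold_locales (rule subalgebra_natural_filtration)
  let ?E = "\<lambda>e. {\<omega> \<in> space P. \<xi> (Suc t) \<omega> = e}"
  let ?I = "{- 1, 0, 1 :: int}"
  have E: "?E e \<in> events" for e by (rule increment_event) simp
  have G: "G e \<in> borel_measurable (\<F> t)" "integrable P (G e)" for e
    unfolding G_def
    using borel_measurable_max_walk[of "\<lambda>m z. h (max m (z + e)) (z + e)"]
      integrable_max_walk[of "\<lambda>m z. h (max m (z + e)) (z + e)"] by auto
  have int: "integrable P (\<lambda>\<omega>. G e \<omega> * indicator (?E e) \<omega>)" for e
    using integrable_mult_indicator[OF E G(2)] by (simp add: mult.commute)
  have sum_int: "integrable P (\<lambda>\<omega>. \<Sum>e\<in>?I. G e \<omega> * indicator (?E e) \<omega>)"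
    using int by (intro Bochner_Integration.integrable_sum)
  have split: "AE \<omega> in P. h (M (Suc t) \<omega>) (Z (Suc t) \<omega>) = (\<Sum>e\<in>?I. G e \<omega> * indicator (?E e) \<omega>)"
  proof -
    have "AE \<omega> in P. \<xi> (Suc t) \<omega> \<in> ?I" by (rule AE_increment) simp
    with AE_space show ?thesis
    proof eventually_elim
      case (elim \<omega>)
      have "(\<Sum>e\<in>?I. G e \<omega> * indicator (?E e) \<omega>)
          = (\<Sum>e\<in>?I. if e = \<xi> (Suc t) \<omega> then G e \<omega> else 0)"
        using elim(1) by (intro sum.cong) (auto simp: indicator_def)
      also have "\<dots> = G (\<xi> (Suc t) \<omega>) \<omega>"
        using elim(2) by (subst sum.delta) auto
      finally show ?case by (simp add: G_def)
    qed
  qed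
  have summand: "AE \<omega> in P. real_cond_exp P (\<F> t) (\<lambda>\<omega>. G e \<omega> * indicator (?E e) \<omega>) \<omega>
      = G e \<omega> * prob {\<omega> \<in> space P. \<xi> 1 \<omega> = e}" for e
  proof -
    have "AE \<omega> in P. real_cond_exp P (\<F> t) (\<lambda>\<omega>. G e \<omega> * indicator (?E e) \<omega>) \<omega>
        = G e \<omega> * real_cond_exp P (\<F> t) (indicator (?E e)) \<omega>"
      by (rule real_cond_exp_mult[OF G(1) _ int]) (use E in auto)
    moreover have "AE \<omega> in P. real_cond_exp P (\<F> t) (indicator (?E e)) \<omega> = prob (?E e)"
      by (rule real_cond_exp_indicator_indep[OF subalgebra_natural_filtration E indep_past_increment])
    ultimately show ?thesis
      by eventually_elim (simp add: prob_increment[of "Suc t"])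
  qed
  have "AE \<omega> in P. real_cond_exp P (\<F> t) (\<lambda>\<omega>. h (M (Suc t) \<omega>) (Z (Suc t) \<omega>)) \<omega>
      = real_cond_exp P (\<F> t) (\<lambda>\<omega>. \<Sum>e\<in>?I. G e \<omega> * indicator (?E e) \<omega>) \<omega>"
    by (rule real_cond_exp_cong[OF split borel_measurable_integrable[OF integrable_max_walk]
          borel_measurable_integrable[OF sum_int]])
  moreover have "AE \<omega> in P. real_cond_exp P (\<F> t) (\<lambda>\<omega>. \<Sum>e\<in>?I. G e \<omega> * indicator (?E e) \<omega>) \<omega>
      = (\<Sum>e\<in>?I. real_cond_exp P (\<F> t) (\<lambda>\<omega>. G e \<omega> * indicator (?E e) \<omega>) \<omega>)"
    by (rule real_cond_exp_sum[OF int])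
  ultimately show ?thesis
    using summand[of 1, unfolded up] summand[of 0, unfolded stay] summand[of "- 1", unfolded down]
  proof eventually_elim
    case (elim \<omega>)
    then show ?case by (simp add: mult.commute)
  qed
qed

end

section \<open>The difference equations as an averaging property\<close>

text \<open>
  The state at time \<open>t\<close> is given by the maximum \<open>m\<close> and the position \<open>z\<close>. The interior equation
  enters for \<open>z < m\<close>, with its time index \<open>t + 1\<close>; for \<open>t = 0\<close> the
  walk sits at its maximum, which is the assumption \<open>start\<close>.
\<close>

lemma successor_average:
  fixes f :: "nat \<Rightarrow> nat \<Rightarrow> nat \<Rightarrow> real" and m z :: int and t :: nat
  assumes total: "p + q + r = 1"
    and interior: "\<And>t x y. t \<ge> 2 \<Longrightarrow> x \<ge> 1 \<Longrightarrow>
           (p + q) * (1 / 2) * diff_x_plus (diff_x_minus f) t x y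
           - (p - q) * ((diff_x_plus f t x y + diff_x_minus f t x y) / 2)
           + diff_t_minus f t x y = 0"
    and boundary: "\<And>t y. t \<ge> 1 \<Longrightarrow>
           p * diff_y_plus f t 0 y + q * diff_x_plus f t 0 y + diff_t_minus f t 0 y = 0"
    and state: "0 \<le> m" "z \<le> m" and start: "t = 0 \<Longrightarrow> z = m"
  defines "g \<equiv> (\<lambda>e. f (Suc t) (nat (max m (z + e) - (z + e))) (nat (max m (z + e))))"
  shows "p * g 1 + q * g (- 1) + r * g 0 = f t (nat (m - z)) (nat m)"
proof -
  have r: "r = 1 - p - q" using total by simp
  show ?thesis
  proof (cases "z = m")
    case True
    have "p * (f (Suc t) 0 (nat m + 1) - f (Suc t) 0 (nat m))
        + q * (f (Suc t) 1 (nat m) - f (Suc t) 0 (nat m))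
        + (f (Suc t) 0 (nat m) - f t 0 (nat m)) = 0"
      using boundary[of "Suc t" "nat m"]
      by (simp add: diff_y_plus_def diff_x_plus_def diff_t_minus_def)
    moreover have "g 1 = f (Suc t) 0 (nat m + 1)" "g (- 1) = f (Suc t) 1 (nat m)"
      "g 0 = f (Suc t) 0 (nat m)"
      using True state by (simp_all add: g_def nat_add_distrib max_def)
    ultimately show ?thesis using True by (simp add: r algebra_simps)
  next
    case False
    define x where "x = nat (m - z)"
    have x: "x \<ge> 1" using False state by (simp add: x_def)
    have "t \<noteq> 0" using False start by blast
    then have t: "Suc t \<ge> 2" by simp
    have "(p + q) * (1 / 2) * (f (Suc t) (x + 1) (nat m) - f (Suc t) x (nat m)
          - (f (Suc t) x (nat m) - f (Suc t) (x - 1) (nat m)))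
        - (p - q) * ((f (Suc t) (x + 1) (nat m) - f (Suc t) x (nat m)
          + (f (Suc t) x (nat m) - f (Suc t) (x - 1) (nat m))) / 2)
        + (f (Suc t) x (nat m) - f t x (nat m)) = 0"
      using interior[OF t x, of "nat m"]
      by (simp add: diff_x_minus_def diff_x_plus_def diff_t_minus_def)
    moreover have "g 1 = f (Suc t) (x - 1) (nat m)" "g (- 1) = f (Suc t) (x + 1) (nat m)"
      "g 0 = f (Suc t) x (nat m)"
    proof -
      have "nat (m - (z + 1)) = x - 1" "nat (m - (z - 1)) = x + 1"
        using False state by (auto simp: x_def)
      moreover have "max m (z + e) = m" if "e \<le> 1" for e
        using False state that by simp
      ultimately show "g 1 = f (Suc t) (x - 1) (nat m)" "g (- 1) = f (Suc t) (x + 1) (nat m)"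
        "g 0 = f (Suc t) x (nat m)"
        by (simp_all add: g_def x_def)
    qed
    ultimately show ?thesis unfolding x_def[symmetric] by (simp add: r field_simps)
  qed
qed

theorem proposition1:
  fixes P :: "'a measure"
    and \<xi> :: "nat \<Rightarrow> 'a \<Rightarrow> int"
    and p q r :: real
    and f :: "nat \<Rightarrow> nat \<Rightarrow> nat \<Rightarrow> real"
  assumes "prob_space P"
    and "iid_sequence P \<xi>"
    and "p > 0" and "q > 0" and "r \<ge> 0" and "p + q + r = 1"
    and "measure P {\<omega> \<in> space P. \<xi> 1 \<omega> = 1} = p"
    and "measure P {\<omega> \<in> space P. \<xi> 1 \<omega> = - 1} = q"
    and "measure P {\<omega> \<in> space P. \<xi> 1 \<omega> = 0} = r"
    and "\<And>t x y. t \<ge> 2 \<Longrightarrow> x \<ge> 1 \<Longrightarrow>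
           (p + q) * (1 / 2) * diff_x_plus (diff_x_minus f) t x y
           - (p - q) * ((diff_x_plus f t x y + diff_x_minus f t x y) / 2)
           + diff_t_minus f t x y = 0"
    and "\<And>t y. t \<ge> 1 \<Longrightarrow>
           p * diff_y_plus f t 0 y + q * diff_x_plus f t 0 y + diff_t_minus f t 0 y = 0"
  defines "Z \<equiv> walk \<xi>"
    and "M \<equiv> running_max (walk \<xi>)"
  shows "martingale P (natural_filtration P Z)
           (\<lambda>t \<omega>. f t (nat (M t \<omega> - Z t \<omega>)) (nat (M t \<omega>)))"
proof -
  interpret W: lazy_walk P \<xi> p q r
    by (rule lazy_walk.intro[OF assms(1)], unfold_locales) (fact assms)+
  let ?X = "\<lambda>t \<omega>. f t (nat (M t \<omega> - Z t \<omega>)) (nat (M t \<omega>))"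
  show ?thesis
  proof (rule W.martingale_of_one_step)
    show "filtration (space P) (natural_filtration P Z)"
      by (rule filtration_natural_filtration)
    fix t
    let ?h = "\<lambda>t m z. f t (nat (m - z)) (nat m)"
    show "subalgebra P (natural_filtration P Z t)"
      unfolding Z_def by (rule W.subalgebra_natural_filtration)
    show "?X t \<in> borel_measurable (natural_filtration P Z t)"
      unfolding Z_def M_def by (rule W.borel_measurable_max_walk[of "?h t"])
    show "integrable P (?X t)"
      unfolding Z_def M_def by (rule W.integrable_max_walk[of "?h t"])
    show "AE \<omega> in P. real_cond_exp P (natural_filtration P Z t) (?X (Suc t)) \<omega> = ?X t \<omega>"
      using W.cond_exp_one_step[of t "?h (Suc t)"] unfolding Z_def M_def
    proof eventually_elim
      case (elim \<omega>)
      have "0 \<le> running_max (walk \<xi>) t \<omega>" "walk \<xi> t \<omega> \<le> running_max (walk \<xi>) t \<omega>"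
        using le_running_max[of 0 t "walk \<xi>" \<omega>] le_running_max[of t t "walk \<xi>" \<omega>] by auto
      from successor_average[OF assms(6,10,11) this, of t] elim show ?case by simp
    qed
  qed
qed

end
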